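(* The sets $$C_5=\left\{(a,x_1,x_2,x_3)\in\mathbb R\times(\mathbb E\cap\mathbb R^3):\ 0\le a\le1,\ \frac{a\sqrt{(1-|z_1(x)|^2)(1-|z_2(x)|^2)}}{|1-x_1z_1(x)-x_2z_2(x)+x_3z_1(x)z_2(x)|}=1\right\}$$ and $$C_6=\left\{(a,x_1,x_2,x_3)\in\mathbb R\times(\mathbb E\cap\mathbb R^3):\ -1\le a\le0,\ \frac{-a\sqrt{(1-|z_1(x)|^2)(1-|z_2(x)|^2)}}{|1-x_1z_1(x)-x_2z_2(x)+x_3z_1(x)z_2(x)|}=1\right\}$$ are hypersurfaces of class $C^\infty$ in $\mathbb R^4$.
   Context: $\overline{\mathbb D}$ is the closed unit disc in $\mathbb C$. The tetrablock is $\mathbb E=\{(x_1,x_2,x_3)\in\mathbb C^3: 1-x_1z_1-x_2z_2+x_3z_1z_2\ne0 \text{ for all } z_1,z_2\in\overline{\mathbb D}\}$. For $x=(x_1,x_2,x_3)\in\mathbb E\cap\mathbb R^3$ (so $|x_3|<1$), put $\beta_1=\dfrac{x_1-x_2x_3}{1-x_3^2}$, $\beta_2=\dfrac{x_2-x_1x_3}{1-x_3^2}$ (for which $|\beta_1|+|\beta_2|<1$) and $$z_1(x)=\frac{2\beta_1}{1+\beta_1^2-\beta_2^2+\sqrt{(1+\beta_1^2-\beta_2^2)^2-4\beta_1^2}},\qquad z_2(x)=\frac{2\beta_2}{1+\beta_2^2-\beta_1^2+\sqrt{(1+\beta_2^2-\beta_1^2)^2-4\beta_2^2}};$$ these are points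 of $(-1,1)$. A subset $S\subseteq\mathbb R^n$ is a hypersurface of class $C^k$ ($1\le k\le\infty$) if for every $x_0\in S$ there are an open set $U\subseteq\mathbb R^n$ containing $x_0$ and a real-valued function $\rho\in C^k(U)$ such that $\mathrm{grad}\,\rho$ is non-vanishing on $S\cap U$ and $S\cap U=\{x\in U:\rho(x)=0\}$. *)

theory Defs
  imports "HOL-Analysis.Analysis"
begin

primrec times_cont_diff_on ::
  "nat \<Rightarrow> 'a::euclidean_space set \<Rightarrow> ('a \<Rightarrow> real) \<Rightarrow> bool" where
  "times_cont_diff_on 0 U f \<longleftrightarrow> continuous_on U f"
| "times_cont_diff_on (Suc n) U f \<longleftrightarrow>
     (\<forall>x\<in>U. f differentiable (at x)) \<and>
     (\<forall>v. times_cont_diff_on n U (\<lambda>x. frechet_derivative f (at x) v))"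

(* The space C^k(U), for U open and k finite or infinite: derivatives are taken at x in the
   whole space, so only the values of f on U matter. *)
definition C_class_on ::
  "enat \<Rightarrow> 'a::euclidean_space set \<Rightarrow> ('a \<Rightarrow> real) \<Rightarrow> bool" where
  "C_class_on k U f \<longleftrightarrow> (\<forall>n. enat n \<le> k \<longrightarrow> times_cont_diff_on n U f)"

definition hypersurface :: "enat \<Rightarrow> (real ^ 'n) set \<Rightarrow> bool" where
  "hypersurface k S \<longleftrightarrow> 1 \<le> k \<and>
     (\<forall>x0\<in>S. \<exists>U \<rho>. open U \<and> x0 \<in> U \<and> C_class_on k U \<rho> \<and>
        (\<forall>x\<in>S \<inter> U. \<exists>D. GDERIV \<rho> x :> D \<and> D \<noteq> 0) \<and>
        S \<inter> U = {x\<in>U. \<rho> x = 0})"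

definition tetrablock :: "(complex ^ 3) set" where
  "tetrablock = {x. \<forall>z1\<in>cball 0 1. \<forall>z2\<in>cball 0 1.
     1 - x$1 * z1 - x$2 * z2 + x$3 * z1 * z2 \<noteq> 0}"

definition real_tetrablock :: "(real ^ 3) set" where
  "real_tetrablock = {x. (\<chi> i. complex_of_real (x$i)) \<in> tetrablock}"

definition beta1 :: "real ^ 3 \<Rightarrow> real" where
  "beta1 x = (x$1 - x$2 * x$3) / (1 - (x$3)\<^sup>2)"

definition beta2 :: "real ^ 3 \<Rightarrow> real" where
  "beta2 x = (x$2 - x$1 * x$3) / (1 - (x$3)\<^sup>2)"

definition zeta1 :: "real ^ 3 \<Rightarrow> real" where
  "zeta1 x = 2 * beta1 x /
     (1 + (beta1 x)\<^sup>2 - (beta2 x)\<^sup>2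
        + sqrt ((1 + (beta1 x)\<^sup>2 - (beta2 x)\<^sup>2)\<^sup>2 - 4 * (beta1 x)\<^sup>2))"

definition zeta2 :: "real ^ 3 \<Rightarrow> real" where
  "zeta2 x = 2 * beta2 x /
     (1 + (beta2 x)\<^sup>2 - (beta1 x)\<^sup>2
        + sqrt ((1 + (beta2 x)\<^sup>2 - (beta1 x)\<^sup>2)\<^sup>2 - 4 * (beta2 x)\<^sup>2))"

definition C5 :: "(real ^ 4) set" where
  "C5 = {vector [a, x$1, x$2, x$3] | a x. x \<in> real_tetrablock \<and> 0 \<le> a \<and> a \<le> 1 \<and>
     a * sqrt ((1 - \<bar>zeta1 x\<bar>\<^sup>2) * (1 - \<bar>zeta2 x\<bar>\<^sup>2)) /
       \<bar>1 - x$1 * zeta1 x - x$2 * zeta2 x + x$3 * zeta1 x * zeta2 x\<bar> = 1}"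

definition C6 :: "(real ^ 4) set" where
  "C6 = {vector [a, x$1, x$2, x$3] | a x. x \<in> real_tetrablock \<and> -1 \<le> a \<and> a \<le> 0 \<and>
     - a * sqrt ((1 - \<bar>zeta1 x\<bar>\<^sup>2) * (1 - \<bar>zeta2 x\<bar>\<^sup>2)) /
       \<bar>1 - x$1 * zeta1 x - x$2 * zeta2 x + x$3 * zeta1 x * zeta2 x\<bar> = 1}"

end

theory Submission
  imports Defs
begin

text \<open>
  Write \<open>G(x)\<close> for the quotient multiplying \<open>a\<close> in the definition of \<open>C5\<close>. If \<open>G\<close> is smooth and
  positive on the open set of real points of the tetrablock, then \<open>a * G(x) = 1\<close> is the graph of the
  smooth function \<open>1 / G\<close>, and its defining function \<open>a * G(x) - 1\<close> has the nonzero derivative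
  \<open>G(x)\<close> in the direction of \<open>a\<close>. The only other condition in \<open>C5\<close> is \<open>0 \<le> a \<le> 1\<close>, which would cut
  the graph off along an edge were it not implied by the equation; so the heart of the matter is
  \<open>G \<ge> 1\<close>. The set \<open>C6\<close> is the mirror image of \<open>C5\<close> under \<open>a \<mapsto> -a\<close>.

  Both the smoothness and the bound become transparent in the coordinates
  \<open>u = \<beta>\<^sub>1 + \<beta>\<^sub>2 = (x\<^sub>1 + x\<^sub>2) / (1 + x\<^sub>3)\<close> and \<open>v = \<beta>\<^sub>1 - \<beta>\<^sub>2 = (x\<^sub>1 - x\<^sub>2) / (1 - x\<^sub>3)\<close>.
  The function \<open>1 - x\<^sub>1 z\<^sub>1 - x\<^sub>2 z\<^sub>2 + x\<^sub>3 z\<^sub>1 z\<^sub>2\<close> is positive for real \<open>z\<^sub>1, z\<^sub>2\<close> in \<open>[-1, 1]\<close>,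
  because it does not vanish and is \<open>1\<close> at the origin; its values at the four corners say that
  \<open>\<bar>u\<bar> < 1\<close> and \<open>\<bar>v\<bar> < 1\<close>. The radicand in \<open>z\<^sub>1\<close> and in \<open>z\<^sub>2\<close> is \<open>(1 - u\<^sup>2) (1 - v\<^sup>2) > 0\<close>, and if
  \<open>u = tanh p\<close>, \<open>v = tanh q\<close>, then \<open>z\<^sub>1 = tanh ((p + q) / 2)\<close> and \<open>z\<^sub>2 = tanh ((p - q) / 2)\<close>.
  The addition theorem for \<open>tanh\<close> therefore gives
  \<open>z\<^sub>1 + z\<^sub>2 = u (1 + z\<^sub>1 z\<^sub>2)\<close> and \<open>z\<^sub>1 - z\<^sub>2 = v (1 - z\<^sub>1 z\<^sub>2)\<close>, from which, with \<open>w = z\<^sub>1 z\<^sub>2\<close> and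
  \<open>P = (1 - z\<^sub>1\<^sup>2) (1 - z\<^sub>2\<^sup>2)\<close>, the denominator of \<open>G\<close> equals \<open>P (1 - x\<^sub>3 w) / (1 - w\<^sup>2)\<close>.
  Since \<open>P \<le> (1 - \<bar>w\<bar>)\<^sup>2\<close> and \<open>1 - x\<^sub>3 w \<le> 1 + \<bar>w\<bar>\<close>, this is at most \<open>sqrt P\<close>, that is, \<open>G \<ge> 1\<close>.
\<close>

section \<open>Calculus of functions of class \<open>C\<^sup>k\<close>\<close>

lemma times_cont_diff_on_cong:
  assumes "open U" "\<And>x. x \<in> U \<Longrightarrow> f x = g x" "times_cont_diff_on n U f"
  shows "times_cont_diff_on n U g"
  using assms(2,3)
proof (induction n arbitrary: f g)
  case 0
  then show ?case by (simp cong: continuous_on_cong)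
next
  case (Suc n)
  have d: "(g has_derivative frechet_derivative f (at x)) (at x)" if "x \<in> U" for x
  proof (rule has_derivative_transform_within_open[OF _ \<open>open U\<close> that])
    show "(f has_derivative frechet_derivative f (at x)) (at x)"
      using Suc.prems(2) that frechet_derivative_works by auto
  qed (rule Suc.prems(1))
  have "times_cont_diff_on n U (\<lambda>x. frechet_derivative g (at x) v)" for v
  proof (rule Suc.IH)
    show "times_cont_diff_on n U (\<lambda>x. frechet_derivative f (at x) v)"
      using Suc.prems(2) by simp
  qed (simp add: frechet_derivative_at[OF d, symmetric])
  then show ?case using d by (auto simp: differentiable_def)
qed

text \<open>Verifies \<open>C\<^sup>n\<^sup>+\<^sup>1\<close> with an explicit formula for the derivative in place of the
  choice made by \<^const>\<open>frechet_derivative\<close>.\<close>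

lemma times_cont_diff_on_SucI:
  assumes "open U" "\<And>x. x \<in> U \<Longrightarrow> (f has_derivative f' x) (at x)"
    "\<And>v. times_cont_diff_on n U (\<lambda>x. f' x v)"
  shows "times_cont_diff_on (Suc n) U f"
proof -
  have "times_cont_diff_on n U (\<lambda>x. frechet_derivative f (at x) v)" for v
    using times_cont_diff_on_cong[OF \<open>open U\<close> _ assms(3)[of v]]
      frechet_derivative_at[OF assms(2)] by simp
  then show ?thesis using assms(2) by (auto simp: differentiable_def)
qed

lemma times_cont_diff_on_SucD:
  assumes "times_cont_diff_on (Suc n) U f"
  shows "times_cont_diff_on n U f"
  using assms
proof (induction n arbitrary: f)
  case 0
  then show ?case
    by (auto intro!: continuous_at_imp_continuous_on differentiable_imp_continuous_within)
next
  case (Suc n)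
  then show ?case by (metis times_cont_diff_on.simps(2))
qed

lemma times_cont_diff_on_has_derivative:
  assumes "times_cont_diff_on (Suc n) U f" "x \<in> U"
  shows "(f has_derivative frechet_derivative f (at x)) (at x)"
  using assms frechet_derivative_works by auto

lemma times_cont_diff_on_const: "times_cont_diff_on n U (\<lambda>x. c)"
  by (induction n arbitrary: c) auto

lemma times_cont_diff_on_linear:
  assumes "open U" "bounded_linear f"
  shows "times_cont_diff_on n U f"
proof (cases n)
  case 0
  then show ?thesis
    using assms(2) by (simp add: linear_continuous_on)
next
  case (Suc m)
  then show ?thesis
    using times_cont_diff_on_SucI[OF assms(1) bounded_linear_imp_has_derivative[OF assms(2)]]
      times_cont_diff_on_const by blast
qed

lemma times_cont_diff_on_add:
  assumes "open U" "times_cont_diff_on n U f" "times_cont_diff_on n U g"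
  shows "times_cont_diff_on n U (\<lambda>x. f x + g x)"
  using assms(2,3)
proof (induction n arbitrary: f g)
  case 0
  then show ?case by (auto intro: continuous_intros)
next
  case (Suc n)
  show ?case
  proof (rule times_cont_diff_on_SucI[OF \<open>open U\<close>])
    fix x assume "x \<in> U"
    then show "((\<lambda>x. f x + g x) has_derivative
        (\<lambda>v. frechet_derivative f (at x) v + frechet_derivative g (at x) v)) (at x)"
      using Suc.prems by (intro has_derivative_add times_cont_diff_on_has_derivative)
  qed (use Suc in auto)
qed

lemma times_cont_diff_on_mult:
  assumes "open U" "times_cont_diff_on n U f" "times_cont_diff_on n U g"
  shows "times_cont_diff_on n U (\<lambda>x. f x * g x)"
  using assms(2,3)
proof (induction n arbitrary: f g)
  case 0
  then show ?case by (auto intro: continuous_intros)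
next
  case (Suc n)
  note lower = times_cont_diff_on_SucD[OF Suc.prems(1)] times_cont_diff_on_SucD[OF Suc.prems(2)]
  show ?case
  proof (rule times_cont_diff_on_SucI[OF \<open>open U\<close>])
    fix x assume "x \<in> U"
    then show "((\<lambda>x. f x * g x) has_derivative
        (\<lambda>v. f x * frechet_derivative g (at x) v + frechet_derivative f (at x) v * g x)) (at x)"
      using Suc.prems by (intro has_derivative_mult times_cont_diff_on_has_derivative)
  next
    show "times_cont_diff_on n U
        (\<lambda>x. f x * frechet_derivative g (at x) v + frechet_derivative f (at x) v * g x)" for v
      using Suc lower by (intro times_cont_diff_on_add[OF \<open>open U\<close>] Suc.IH) auto
  qed
qed

text \<open>Real powers cover quotients and square roots together, and the induction closes because the
  derivative of a power is again a power up to a factor; hence the exponent must vary.\<close>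

lemma times_cont_diff_on_powr:
  assumes "open U" "times_cont_diff_on n U f" "\<And>x. x \<in> U \<Longrightarrow> f x > 0"
  shows "times_cont_diff_on n U (\<lambda>x. f x powr s)"
  using assms(2)
proof (induction n arbitrary: s)
  case 0
  then show ?case using assms(3) by (auto intro!: continuous_intros) (metis less_irrefl)
next
  case (Suc n)
  note deriv = times_cont_diff_on_has_derivative[OF Suc.prems]
  show ?case
  proof (rule times_cont_diff_on_SucI[OF \<open>open U\<close>])
    fix x assume x: "x \<in> U"
    show "((\<lambda>x. f x powr s) has_derivative
        (\<lambda>v. s * f x powr (s - 1) * frechet_derivative f (at x) v)) (at x)"
      using assms(3)[OF x]
      by (auto intro!: derivative_eq_intros deriv[OF x] simp: powr_diff)
  next
    show "times_cont_diff_on n U (\<lambda>x. s * f x powr (s - 1) * frechet_derivative f (at x) v)" for v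
      using Suc times_cont_diff_on_SucD[OF Suc.prems]
      by (intro times_cont_diff_on_mult[OF \<open>open U\<close>] times_cont_diff_on_const) auto
  qed
qed

lemma C_class_on_cong:
  assumes "open U" "\<And>x. x \<in> U \<Longrightarrow> f x = g x" "C_class_on k U f"
  shows "C_class_on k U g"
  using assms times_cont_diff_on_cong unfolding C_class_on_def by blast

lemma C_class_on_const: "C_class_on k U (\<lambda>x. c)"
  by (simp add: C_class_on_def times_cont_diff_on_const)

lemma C_class_on_linear: "open U \<Longrightarrow> bounded_linear f \<Longrightarrow> C_class_on k U f"
  by (simp add: C_class_on_def times_cont_diff_on_linear)

lemma C_class_on_add:
  "open U \<Longrightarrow> C_class_on k U f \<Longrightarrow> C_class_on k U g \<Longrightarrow> C_class_on k U (\<lambda>x. f x + g x)"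
  by (simp add: C_class_on_def times_cont_diff_on_add)

lemma C_class_on_mult:
  "open U \<Longrightarrow> C_class_on k U f \<Longrightarrow> C_class_on k U g \<Longrightarrow> C_class_on k U (\<lambda>x. f x * g x)"
  by (simp add: C_class_on_def times_cont_diff_on_mult)

lemma C_class_on_diff:
  assumes "open U" "C_class_on k U f" "C_class_on k U g"
  shows "C_class_on k U (\<lambda>x. f x - g x)"
  using C_class_on_add[OF assms(1,2) C_class_on_mult[OF assms(1) C_class_on_const[of k U "-1"] assms(3)]]
  by simp

lemma C_class_on_power2:
  "open U \<Longrightarrow> C_class_on k U f \<Longrightarrow> C_class_on k U (\<lambda>x. (f x)\<^sup>2)"
  by (simp add: power2_eq_square C_class_on_mult)

lemma C_class_on_powr:
  assumes "open U" "C_class_on k U f" "\<And>x. x \<in> U \<Longrightarrow> f x > 0"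
  shows "C_class_on k U (\<lambda>x. f x powr s)"
  using assms by (simp add: C_class_on_def times_cont_diff_on_powr)

lemma C_class_on_sqrt:
  assumes "open U" "C_class_on k U f" "\<And>x. x \<in> U \<Longrightarrow> f x > 0"
  shows "C_class_on k U (\<lambda>x. sqrt (f x))"
  by (rule C_class_on_cong[OF \<open>open U\<close> _ C_class_on_powr[OF assms, of "1/2"]])
     (simp add: assms(3) less_imp_le powr_half_sqrt)

lemma C_class_on_divide:
  assumes "open U" "C_class_on k U f" "C_class_on k U g" "\<And>x. x \<in> U \<Longrightarrow> g x > 0"
  shows "C_class_on k U (\<lambda>x. f x / g x)"
  by (rule C_class_on_cong[OF \<open>open U\<close> _
        C_class_on_mult[OF \<open>open U\<close> assms(2) C_class_on_powr[OF assms(1,3,4), of "-1"]]])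
     (use assms(4) in \<open>auto simp: powr_minus divide_inverse less_imp_le\<close>)

lemmas C_class_on_intros =
  C_class_on_const C_class_on_add C_class_on_diff C_class_on_mult C_class_on_power2
  C_class_on_sqrt C_class_on_divide

lemma C_class_on_imp_differentiable:
  assumes "C_class_on k U f" "1 \<le> k" "x \<in> U"
  shows "f differentiable (at x)"
proof -
  have "times_cont_diff_on (Suc 0) U f"
    using assms(1,2) unfolding C_class_on_def by (metis One_nat_def one_enat_def)
  then show ?thesis using assms(3) by simp
qed

text \<open>One nonvanishing directional derivative suffices to see that the gradient is nonzero.\<close>

lemma nonzero_gradientI:
  fixes f :: "'a::euclidean_space \<Rightarrow> real"
  assumes "f differentiable (at x)"
    and dir: "((\<lambda>t. f (x + t *\<^sub>R e)) has_real_derivative c) (at 0)" and "c \<noteq> 0"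
  shows "\<exists>D. GDERIV f x :> D \<and> D \<noteq> 0"
proof -
  obtain f' where f': "(f has_derivative f') (at x)"
    using assms(1) by (auto simp: differentiable_def)
  then have lin: "linear f'" by (rule has_derivative_linear)
  define D where "D = (\<Sum>b\<in>Basis. f' b *\<^sub>R b)"
  have repr: "f' h = inner h D" for h
  proof -
    have "f' h = f' (\<Sum>b\<in>Basis. inner h b *\<^sub>R b)"
      by (simp add: euclidean_representation)
    also have "\<dots> = inner h D"
      by (simp add: D_def linear_sum[OF lin] linear_scale[OF lin] inner_sum_right mult.commute)
    finally show ?thesis .
  qed
  have "((\<lambda>t. f (x + t *\<^sub>R e)) has_derivative (\<lambda>t. f' (t *\<^sub>R e))) (at 0)"
    by (rule has_derivative_compose[of "\<lambda>t. x + t *\<^sub>R e" "\<lambda>t. t *\<^sub>R e" 0 UNIV f f', simplified])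
       (auto intro!: derivative_eq_intros f')
  then have "(\<lambda>t. f' (t *\<^sub>R e)) = (*) c"
    using dir unfolding has_field_derivative_def by (rule has_derivative_unique)
  then have "f' e = c"
    by (metis mult.right_neutral scaleR_one)
  then have "D \<noteq> 0" using repr \<open>c \<noteq> 0\<close> by force
  moreover have "GDERIV f x :> D"
    using f' repr unfolding gderiv_def by (metis (no_types, lifting) ext)
  ultimately show ?thesis by blast
qed

section \<open>Real points of the tetrablock\<close>

text \<open>The nonvanishing condition ranges over a compact set of \<open>(z\<^sub>1, z\<^sub>2)\<close>, so the set of \<open>x\<close> that
  violate it is the projection of a closed set along a compact factor.\<close>

lemma open_real_tetrablock: "open real_tetrablock"
proof -
  define T :: "((complex \<times> complex) \<times> (real ^ 3)) set" where
    "T = {p. 1 - complex_of_real (snd p $ 1) * fst (fst p)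
       - complex_of_real (snd p $ 2) * snd (fst p)
       + complex_of_real (snd p $ 3) * fst (fst p) * snd (fst p) = 0}"
  have "closed T"
    unfolding T_def by (intro closed_Collect_eq continuous_intros)
  then have "closed {x. \<exists>z. z \<in> cball 0 1 \<times> cball 0 1 \<and> (z, x) \<in> T}"
    by (intro closed_compact_projection compact_Times compact_cball)
  moreover have "- real_tetrablock = {x. \<exists>z. z \<in> cball 0 1 \<times> cball 0 1 \<and> (z, x) \<in> T}"
    by (auto simp: real_tetrablock_def tetrablock_def T_def)
  ultimately have "closed (- real_tetrablock)" by metis
  then show ?thesis by (simp only: open_closed)
qed

text \<open>Along the segment from \<open>0\<close> to \<open>(z\<^sub>1, z\<^sub>2)\<close>, which stays in the bidisc, the real value starts
  at \<open>1\<close> and never vanishes.\<close>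

lemma real_tetrablock_affine_pos:
  assumes x: "x \<in> real_tetrablock" and z: "\<bar>z1\<bar> \<le> 1" "\<bar>z2\<bar> \<le> 1"
  shows "0 < 1 - x$1 * z1 - x$2 * z2 + x$3 * z1 * z2"
proof (rule ccontr)
  define f where "f t = 1 - x$1 * (t * z1) - x$2 * (t * z2) + x$3 * (t * z1) * (t * z2)" for t :: real
  assume "\<not> ?thesis"
  then have "f 1 \<le> 0" by (simp add: f_def)
  moreover have "0 \<le> f 0" by (simp add: f_def)
  moreover have "continuous_on {0..1} f"
    unfolding f_def by (intro continuous_intros)
  ultimately obtain t where t: "0 \<le> t" "t \<le> 1" "f t = 0"
    using IVT2'[of f 1 0 0] by auto
  have le: "\<bar>t * z\<bar> \<le> 1" if "\<bar>z\<bar> \<le> 1" for z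
    using t that by (simp add: abs_mult mult_le_one)
  have "complex_of_real (t * z1) \<in> cball 0 1" "complex_of_real (t * z2) \<in> cball 0 1"
    using le[OF z(1)] le[OF z(2)] by (simp_all only: mem_cball_0 norm_of_real)
  then have "1 - complex_of_real (x$1) * complex_of_real (t * z1)
      - complex_of_real (x$2) * complex_of_real (t * z2)
      + complex_of_real (x$3) * complex_of_real (t * z1) * complex_of_real (t * z2) \<noteq> 0"
    using x unfolding real_tetrablock_def tetrablock_def by auto
  then have "complex_of_real (f t) \<noteq> 0"
    by (simp add: f_def)
  with t show False by simp
qed

text \<open>Positivity at the four corners \<open>z\<^sub>1, z\<^sub>2 = \<plusminus>1\<close> places \<open>x\<close> in the open tetrahedron from which
  the tetrablock takes its name.\<close>

lemma real_tetrablock_bounds: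
  assumes x: "x \<in> real_tetrablock"
  shows "\<bar>x$3\<bar> < 1" "\<bar>x$1 + x$2\<bar> < 1 + x$3" "\<bar>x$1 - x$2\<bar> < 1 - x$3"
  using real_tetrablock_affine_pos[OF x, of 1 1] real_tetrablock_affine_pos[OF x, of 1 "-1"]
    real_tetrablock_affine_pos[OF x, of "-1" 1] real_tetrablock_affine_pos[OF x, of "-1" "-1"]
  by auto

lemma beta_sum_diff:
  assumes "\<bar>x$3\<bar> < 1"
  shows "beta1 x + beta2 x = (x$1 + x$2) / (1 + x$3)"
    and "beta1 x - beta2 x = (x$1 - x$2) / (1 - x$3)"
proof -
  have nz: "1 + x$3 \<noteq> 0" "1 - x$3 \<noteq> 0" and sq: "1 - (x$3)\<^sup>2 = (1 + x$3) * (1 - x$3)"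
    using assms by (auto simp: power2_eq_square algebra_simps)
  have "beta1 x + beta2 x = ((x$1 + x$2) * (1 - x$3)) / ((1 + x$3) * (1 - x$3))"
    unfolding beta1_def beta2_def sq by (simp add: add_divide_distrib[symmetric] algebra_simps)
  then show "beta1 x + beta2 x = (x$1 + x$2) / (1 + x$3)" using nz by simp
  have "beta1 x - beta2 x = ((x$1 - x$2) * (1 + x$3)) / ((1 + x$3) * (1 - x$3))"
    unfolding beta1_def beta2_def sq by (simp add: diff_divide_distrib[symmetric] algebra_simps)
  then show "beta1 x - beta2 x = (x$1 - x$2) / (1 - x$3)" using nz by simp
qed

lemma beta_bounds:
  assumes x: "x \<in> real_tetrablock"
  shows "\<bar>beta1 x + beta2 x\<bar> < 1" "\<bar>beta1 x - beta2 x\<bar> < 1"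
  using real_tetrablock_bounds[OF x] by (auto simp: beta_sum_diff abs_divide)

section \<open>The points \<open>z\<^sub>1\<close> and \<open>z\<^sub>2\<close>\<close>

lemma radicand_factorization:
  "(1 + b\<^sup>2 - c\<^sup>2)\<^sup>2 - 4 * b\<^sup>2 = (1 - (b + c)\<^sup>2) * (1 - (b - c)\<^sup>2)" for b c :: real
  by algebra

lemma radicand_pos:
  fixes b c :: real
  assumes "\<bar>b + c\<bar> < 1" "\<bar>b - c\<bar> < 1"
  shows "0 < (1 + b\<^sup>2 - c\<^sup>2)\<^sup>2 - 4 * b\<^sup>2"
  unfolding radicand_factorization
  by (rule mult_pos_pos) (use assms in \<open>simp_all add: abs_square_less_1\<close>)

text \<open>The difference of the two sides is \<open>(1 - \<bar>b\<bar>)\<^sup>2 - c\<^sup>2\<close>, which is positive since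
  \<open>\<bar>b\<bar> + \<bar>c\<bar> < 1\<close>.\<close>

lemma denominator_bound:
  fixes b c :: real
  assumes "\<bar>b + c\<bar> < 1" "\<bar>b - c\<bar> < 1"
  shows "2 * \<bar>b\<bar> < 1 + b\<^sup>2 - c\<^sup>2"
proof -
  have "0 < (1 - b + c) * (1 - b - c)" "0 < (1 + b + c) * (1 + b - c)"
    using assms by (auto intro!: mult_pos_pos)
  then show ?thesis by (auto simp: algebra_simps power2_eq_square abs_if)
qed

lemma zeta_bounds:
  assumes x: "x \<in> real_tetrablock"
  shows "\<bar>zeta1 x\<bar> < 1" "\<bar>zeta2 x\<bar> < 1"
proof -
  note b = beta_bounds[OF x]
  have b': "\<bar>beta2 x + beta1 x\<bar> < 1" "\<bar>beta2 x - beta1 x\<bar> < 1" using b by auto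
  have *: "\<bar>2 * p / (A + sqrt B)\<bar> < 1" if "2 * \<bar>p\<bar> < A" "0 < B" for p A B :: real
  proof -
    have "\<bar>2 * p\<bar> < A + sqrt B"
      using that(1) real_sqrt_gt_zero[OF that(2)] by linarith
    then show ?thesis by (simp add: abs_divide)
  qed
  show "\<bar>zeta1 x\<bar> < 1"
    unfolding zeta1_def by (rule *[OF denominator_bound[OF b] radicand_pos[OF b]])
  show "\<bar>zeta2 x\<bar> < 1"
    unfolding zeta2_def by (rule *[OF denominator_bound[OF b'] radicand_pos[OF b']])
qed

text \<open>The addition theorem for \<open>tanh\<close> with its arguments eliminated: \<open>u = tanh p\<close>, \<open>v = tanh q\<close>,
  \<open>s = tanh ((p + q) / 2)\<close>, \<open>t = tanh ((p - q) / 2)\<close>, and for positive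
  \<open>R\<close> one has \<open>R = 1 / (cosh p * cosh q)\<close>.\<close>

lemma half_angle_sum:
  fixes u v R :: real
  assumes R: "R\<^sup>2 = (1 - u\<^sup>2) * (1 - v\<^sup>2)" and nz: "1 + u * v + R \<noteq> 0" "1 - u * v + R \<noteq> 0"
  defines "s \<equiv> (u + v) / (1 + u * v + R)" and "t \<equiv> (u - v) / (1 - u * v + R)"
  shows "s + t = u * (1 + s * t)"
proof -
  define D E where "D = 1 + u * v + R" and "E = 1 - u * v + R"
  have nz': "D \<noteq> 0" "E \<noteq> 0" using nz by (simp_all add: D_def E_def)
  then have st: "s * D = u + v" "t * E = u - v"
    unfolding s_def t_def D_def[symmetric] E_def[symmetric] by simp_all
  have "D * E = 1 + 2 * R + R\<^sup>2 - (u * v)\<^sup>2"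
    by (simp add: D_def E_def power2_eq_square algebra_simps)
  also have "\<dots> = 2 + 2 * R - u\<^sup>2 - v\<^sup>2"
    unfolding R by (simp add: power2_eq_square algebra_simps)
  finally have DE: "D * E = 2 + 2 * R - u\<^sup>2 - v\<^sup>2" .
  have "(s + t - u * (1 + s * t)) * (D * E)
      = (s * D) * E + (t * E) * D - u * (D * E + (s * D) * (t * E))"
    by (simp add: algebra_simps)
  also have "\<dots> = (u + v) * E + (u - v) * D - u * (2 + 2 * R - u\<^sup>2 - v\<^sup>2 + (u + v) * (u - v))"
    unfolding st DE ..
  also have "\<dots> = 0"
    by (simp add: D_def E_def power2_eq_square algebra_simps)
  finally show ?thesis using nz' by simp
qed

lemma zeta_sum_diff:
  assumes x: "x \<in> real_tetrablock"
  shows "zeta1 x + zeta2 x = (beta1 x + beta2 x) * (1 + zeta1 x * zeta2 x)"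
    and "zeta1 x - zeta2 x = (beta1 x - beta2 x) * (1 - zeta1 x * zeta2 x)"
proof -
  note b = beta_bounds[OF x]
  have b': "\<bar>beta2 x + beta1 x\<bar> < 1" "\<bar>beta2 x - beta1 x\<bar> < 1" using b by auto
  define u v where "u = beta1 x + beta2 x" and "v = beta1 x - beta2 x"
  define R where "R = sqrt ((1 - u\<^sup>2) * (1 - v\<^sup>2))"
  have rad1: "(1 + (beta1 x)\<^sup>2 - (beta2 x)\<^sup>2)\<^sup>2 - 4 * (beta1 x)\<^sup>2 = (1 - u\<^sup>2) * (1 - v\<^sup>2)"
    and rad2: "(1 + (beta2 x)\<^sup>2 - (beta1 x)\<^sup>2)\<^sup>2 - 4 * (beta2 x)\<^sup>2 = (1 - u\<^sup>2) * (1 - v\<^sup>2)"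
    unfolding u_def v_def by algebra+
  have uv: "1 + (beta1 x)\<^sup>2 - (beta2 x)\<^sup>2 = 1 + u * v" "1 + (beta2 x)\<^sup>2 - (beta1 x)\<^sup>2 = 1 - u * v"
    "2 * beta1 x = u + v" "2 * beta2 x = u - v"
    by (simp_all add: u_def v_def power2_eq_square algebra_simps)
  have z1: "zeta1 x = (u + v) / (1 + u * v + R)"
    unfolding zeta1_def R_def rad1 unfolding uv ..
  have z2: "zeta2 x = (u - v) / (1 - u * v + R)"
    unfolding zeta2_def R_def rad2 unfolding uv ..
  have pos: "0 < (1 - u\<^sup>2) * (1 - v\<^sup>2)"
    using radicand_pos[OF b] rad1 by simp
  then have R: "R\<^sup>2 = (1 - u\<^sup>2) * (1 - v\<^sup>2)" "0 < R" by (simp_all add: R_def)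
  have nz: "1 + u * v + R \<noteq> 0" "1 - u * v + R \<noteq> 0"
    using denominator_bound[OF b] denominator_bound[OF b'] R(2) uv by auto
  show "zeta1 x + zeta2 x = (beta1 x + beta2 x) * (1 + zeta1 x * zeta2 x)"
    using half_angle_sum[OF R(1) nz] unfolding z1 z2 u_def[symmetric] .
  \<comment> \<open>Exchanging \<open>u\<close> and \<open>v\<close> fixes \<open>z\<^sub>1\<close> and negates \<open>z\<^sub>2\<close>.\<close>
  have R': "R\<^sup>2 = (1 - v\<^sup>2) * (1 - u\<^sup>2)" using R(1) by simp
  have "(v - u) / (1 - v * u + R) = - zeta2 x" "(v + u) / (1 + v * u + R) = zeta1 x"
    unfolding z1 z2 minus_divide_left by (simp_all add: mult.commute add.commute)
  then show "zeta1 x - zeta2 x = (beta1 x - beta2 x) * (1 - zeta1 x * zeta2 x)"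
    using half_angle_sum[OF R'] nz by (simp add: mult.commute v_def)
qed

section \<open>The quotient multiplying \<open>a\<close>\<close>

text \<open>The quotient without the absolute values around \<open>z\<^sub>1\<close>, \<open>z\<^sub>2\<close>, which are squared, and around the
  denominator, which is positive on the real tetrablock; in this form its smoothness is visible.\<close>

definition gain :: "real ^ 3 \<Rightarrow> real" where
  "gain x = sqrt ((1 - (zeta1 x)\<^sup>2) * (1 - (zeta2 x)\<^sup>2)) /
     (1 - x$1 * zeta1 x - x$2 * zeta2 x + x$3 * zeta1 x * zeta2 x)"

lemma gain_denominator_pos:
  "x \<in> real_tetrablock \<Longrightarrow> 0 < 1 - x$1 * zeta1 x - x$2 * zeta2 x + x$3 * zeta1 x * zeta2 x"
  by (rule real_tetrablock_affine_pos) (use zeta_bounds less_imp_le in fast)+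

lemma gain_radicand_pos:
  "x \<in> real_tetrablock \<Longrightarrow> 0 < (1 - (zeta1 x)\<^sup>2) * (1 - (zeta2 x)\<^sup>2)"
  by (rule mult_pos_pos) (use zeta_bounds[of x] in \<open>simp_all add: abs_square_less_1\<close>)

text \<open>In \<open>x\<^sub>1 z\<^sub>1 + x\<^sub>2 z\<^sub>2\<close> the points enter only through \<open>z\<^sub>1 \<plusminus> z\<^sub>2\<close>, the coefficients through
  \<open>x\<^sub>1 \<plusminus> x\<^sub>2\<close>, and both pairs are multiples of \<open>\<beta>\<^sub>1 \<plusminus> \<beta>\<^sub>2\<close>.\<close>

lemma gain_denominator_eq:
  assumes x: "x \<in> real_tetrablock"
  defines "w \<equiv> zeta1 x * zeta2 x"
  shows "(1 - x$1 * zeta1 x - x$2 * zeta2 x + x$3 * zeta1 x * zeta2 x) * (1 - w\<^sup>2)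
       = (1 - (zeta1 x)\<^sup>2) * (1 - (zeta2 x)\<^sup>2) * (1 - x$3 * w)"
proof -
  note bd = real_tetrablock_bounds[OF x]
  define u v where "u = beta1 x + beta2 x" and "v = beta1 x - beta2 x"
  have xs: "x$1 + x$2 = u * (1 + x$3)" "x$1 - x$2 = v * (1 - x$3)"
    using bd by (simp_all add: u_def v_def beta_sum_diff)
  have zs: "zeta1 x + zeta2 x = u * (1 + w)" "zeta1 x - zeta2 x = v * (1 - w)"
    unfolding u_def v_def w_def by (rule zeta_sum_diff[OF x])+
  define P where "P = (1 - (zeta1 x)\<^sup>2) * (1 - (zeta2 x)\<^sup>2)"
  have P: "P = (1 + w)\<^sup>2 * (1 - u\<^sup>2)" "P = (1 - w)\<^sup>2 * (1 - v\<^sup>2)"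
  proof -
    have "P = (1 + w)\<^sup>2 - (zeta1 x + zeta2 x)\<^sup>2"
      by (simp add: P_def w_def power2_eq_square algebra_simps)
    also have "\<dots> = (1 + w)\<^sup>2 * (1 - u\<^sup>2)"
      unfolding zs by (simp add: power2_eq_square algebra_simps)
    finally show "P = (1 + w)\<^sup>2 * (1 - u\<^sup>2)" .
    have "P = (1 - w)\<^sup>2 - (zeta1 x - zeta2 x)\<^sup>2"
      by (simp add: P_def w_def power2_eq_square algebra_simps)
    also have "\<dots> = (1 - w)\<^sup>2 * (1 - v\<^sup>2)"
      unfolding zs by (simp add: power2_eq_square algebra_simps)
    finally show "P = (1 - w)\<^sup>2 * (1 - v\<^sup>2)" .
  qed
  define d where "d = 1 - x$1 * zeta1 x - x$2 * zeta2 x + x$3 * zeta1 x * zeta2 x"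
  have "2 * d = (1 + x$3) * (1 + w) + (1 - x$3) * (1 - w)
      - (x$1 + x$2) * (zeta1 x + zeta2 x) - (x$1 - x$2) * (zeta1 x - zeta2 x)"
    by (simp add: d_def w_def algebra_simps)
  also have "\<dots> = (1 + x$3) * ((1 + w) * (1 - u\<^sup>2)) + (1 - x$3) * ((1 - w) * (1 - v\<^sup>2))"
    unfolding xs zs by (simp add: power2_eq_square algebra_simps)
  finally have d: "2 * d = \<dots>" .
  have "2 * (d * (1 - w\<^sup>2)) = (2 * d) * ((1 + w) * (1 - w))"
    by (simp add: power2_eq_square algebra_simps)
  also have "\<dots> = (1 + x$3) * (1 - w) * ((1 + w)\<^sup>2 * (1 - u\<^sup>2))
      + (1 - x$3) * (1 + w) * ((1 - w)\<^sup>2 * (1 - v\<^sup>2))"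
    unfolding d by (simp add: power2_eq_square algebra_simps)
  also have "\<dots> = (1 + x$3) * (1 - w) * P + (1 - x$3) * (1 + w) * P"
    unfolding P[symmetric] ..
  also have "\<dots> = 2 * (P * (1 - x$3 * w))"
    by (simp add: algebra_simps)
  finally show ?thesis by (simp add: P_def d_def)
qed

text \<open>The closed form of the denominator reduces the bound to \<open>z\<^sub>1\<^sup>2 + z\<^sub>2\<^sup>2 \<ge> 2 \<bar>z\<^sub>1 z\<^sub>2\<bar>\<close>.\<close>

lemma gain_ge_1:
  assumes x: "x \<in> real_tetrablock"
  shows "1 \<le> gain x"
proof -
  define w where "w = zeta1 x * zeta2 x"
  define d where "d = 1 - x$1 * zeta1 x - x$2 * zeta2 x + x$3 * zeta1 x * zeta2 x"
  define P where "P = (1 - (zeta1 x)\<^sup>2) * (1 - (zeta2 x)\<^sup>2)"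
  have eq: "d * (1 - w\<^sup>2) = P * (1 - x$3 * w)"
    using gain_denominator_eq[OF x] by (simp add: d_def w_def P_def)
  have "d > 0" "P > 0"
    using gain_denominator_pos[OF x] gain_radicand_pos[OF x] by (simp_all add: d_def P_def)
  have w: "\<bar>w\<bar> < 1"
    using mult_strict_mono'[of "\<bar>zeta1 x\<bar>" 1 "\<bar>zeta2 x\<bar>" 1] zeta_bounds[OF x]
    by (simp add: w_def abs_mult)
  have "P = (1 - \<bar>w\<bar>)\<^sup>2 - (\<bar>zeta1 x\<bar> - \<bar>zeta2 x\<bar>)\<^sup>2"
    by (simp add: P_def w_def abs_mult power2_diff power_mult_distrib algebra_simps)
  then have "P \<le> (1 - \<bar>w\<bar>)\<^sup>2" by simp
  then have sq: "sqrt P \<le> 1 - \<bar>w\<bar>"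
    using w by (intro real_le_lsqrt) auto
  have "\<bar>x$3 * w\<bar> \<le> \<bar>w\<bar>"
    using real_tetrablock_bounds(1)[OF x] by (simp add: abs_mult mult_left_le_one_le)
  then have x3: "1 - x$3 * w \<le> 1 + \<bar>w\<bar>" "0 \<le> 1 - x$3 * w" using w by auto
  have "d * (1 - w\<^sup>2) = sqrt P * (sqrt P * (1 - x$3 * w))"
    using eq \<open>P > 0\<close> by simp
  also have "\<dots> \<le> sqrt P * ((1 - \<bar>w\<bar>) * (1 + \<bar>w\<bar>))"
    using sq x3 \<open>P > 0\<close> w by (intro mult_left_mono mult_mono) auto
  also have "\<dots> = sqrt P * (1 - w\<^sup>2)"
    by (simp add: algebra_simps power2_eq_square)
  finally have "d \<le> sqrt P"
    using w by (simp add: abs_square_less_1 mult_le_cancel_right_pos)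
  moreover have "gain x = sqrt P / d"
    unfolding gain_def d_def P_def ..
  ultimately show ?thesis using \<open>d > 0\<close> by simp
qed

text \<open>The formula for \<open>z\<^sub>1\<close> with \<open>\<beta>\<^sub>1\<close>, \<open>\<beta>\<^sub>2\<close> replaced by functions \<open>f\<close>, \<open>g\<close>; exchanging the two gives
  \<open>z\<^sub>2\<close>. The radicand is positive, so it avoids the point \<open>0\<close> where the square root is not smooth.\<close>

lemma C_class_on_half_angle:
  fixes f g :: "'a::euclidean_space \<Rightarrow> real"
  assumes U: "open U" and fg: "C_class_on k U f" "C_class_on k U g"
    and bd: "\<And>y. y \<in> U \<Longrightarrow> \<bar>f y + g y\<bar> < 1" "\<And>y. y \<in> U \<Longrightarrow> \<bar>f y - g y\<bar> < 1"
  shows "C_class_on k U (\<lambda>y. 2 * f y /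
    (1 + (f y)\<^sup>2 - (g y)\<^sup>2 + sqrt ((1 + (f y)\<^sup>2 - (g y)\<^sup>2)\<^sup>2 - 4 * (f y)\<^sup>2)))"
proof -
  have pos: "0 < (1 + (f y)\<^sup>2 - (g y)\<^sup>2)\<^sup>2 - 4 * (f y)\<^sup>2" if "y \<in> U" for y
    using radicand_pos bd that by blast
  have "0 < 1 + (f y)\<^sup>2 - (g y)\<^sup>2 + sqrt ((1 + (f y)\<^sup>2 - (g y)\<^sup>2)\<^sup>2 - 4 * (f y)\<^sup>2)" if "y \<in> U" for y
    using denominator_bound[OF bd[OF that]] real_sqrt_gt_zero[OF pos[OF that]] by linarith
  with pos show ?thesis by (intro C_class_on_intros U fg) auto
qed

lemma C_class_on_gain:
  fixes X :: "'a::euclidean_space \<Rightarrow> real ^ 3"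
  assumes U: "open U" and X: "\<And>i. C_class_on k U (\<lambda>y. X y $ i)"
    and sub: "X ` U \<subseteq> real_tetrablock"
  shows "C_class_on k U (\<lambda>y. gain (X y))"
proof -
  have T: "X y \<in> real_tetrablock" if "y \<in> U" for y using sub that by blast
  have pos: "0 < 1 - (X y $ 3)\<^sup>2" if "y \<in> U" for y
    using real_tetrablock_bounds(1)[OF T[OF that]] by (simp add: abs_square_less_1)
  have \<beta>: "C_class_on k U (\<lambda>y. beta1 (X y))" "C_class_on k U (\<lambda>y. beta2 (X y))"
    unfolding beta1_def beta2_def by (intro C_class_on_intros U X pos; assumption)+
  have b: "\<bar>beta1 (X y) + beta2 (X y)\<bar> < 1" "\<bar>beta1 (X y) - beta2 (X y)\<bar> < 1"
    "\<bar>beta2 (X y) + beta1 (X y)\<bar> < 1" "\<bar>beta2 (X y) - beta1 (X y)\<bar> < 1" if "y \<in> U" for y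
    using beta_bounds[OF T[OF that]] by auto
  have \<zeta>: "C_class_on k U (\<lambda>y. zeta1 (X y))" "C_class_on k U (\<lambda>y. zeta2 (X y))"
    unfolding zeta1_def zeta2_def
    using C_class_on_half_angle[OF U \<beta> b(1,2)] C_class_on_half_angle[OF U \<beta>(2,1) b(3,4)]
    by blast+
  show ?thesis
    unfolding gain_def
    by (intro C_class_on_intros U X \<zeta> gain_radicand_pos gain_denominator_pos T) assumption+
qed

section \<open>The two hypersurfaces\<close>

text \<open>One neighbourhood and one defining function serve for all points: the full preimage of the real
  tetrablock in \<open>\<real>\<^sup>4\<close>, and \<open>\<sigma> a G(x) - 1\<close>, whose derivative in the direction of \<open>a\<close> is
  \<open>\<sigma> G(x)\<close>. With \<open>\<sigma> = 1\<close> the set is \<open>C5\<close>, with \<open>\<sigma> = -1\<close> it is \<open>C6\<close>.\<close>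

lemma hypersurface_graph_gain:
  fixes \<sigma> :: real
  assumes "\<sigma> \<noteq> 0"
  defines "pr \<equiv> \<lambda>y :: real ^ 4. vector [y$2, y$3, y$4] :: real ^ 3"
  shows "hypersurface \<infinity> {y. pr y \<in> real_tetrablock \<and> \<sigma> * y$1 * gain (pr y) = 1}"
proof -
  define U where "U = pr -` real_tetrablock"
  define \<rho> where "\<rho> y = \<sigma> * y$1 * gain (pr y) - 1" for y :: "real ^ 4"
  have pr_nth: "pr y $ 1 = y$2" "pr y $ 2 = y$3" "pr y $ 3 = y$4" for y
    by (simp_all add: pr_def)
  have "linear pr"
    by (rule linearI) (simp_all add: vec_eq_iff forall_3 pr_nth)
  then have lin: "bounded_linear pr" by (rule linear_conv_bounded_linear[THEN iffD1])
  have U: "open U"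
    unfolding U_def using open_real_tetrablock
    by (intro open_vimage linear_continuous_on lin)
  have nth: "bounded_linear (\<lambda>y. pr y $ i)" for i
    using bounded_linear_compose[OF bounded_linear_vec_nth lin] .
  have "C_class_on \<infinity> U (\<lambda>y. gain (pr y))"
    by (intro C_class_on_gain U C_class_on_linear nth) (auto simp: U_def)
  then have smooth: "C_class_on \<infinity> U \<rho>"
    unfolding \<rho>_def
    by (intro C_class_on_intros U C_class_on_linear[OF U bounded_linear_vec_nth])
  have grad: "\<exists>D. GDERIV \<rho> y :> D \<and> D \<noteq> 0" if y: "y \<in> U" for y
  proof (rule nonzero_gradientI)
    show "\<rho> differentiable (at y)"
      using C_class_on_imp_differentiable[OF smooth _ y] by simp
    have "pr (y + t *\<^sub>R axis 1 1) = pr y" for t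
      by (simp add: vec_eq_iff forall_3 pr_nth axis_def)
    then have "\<rho> (y + t *\<^sub>R axis 1 1) = \<sigma> * (y$1 + t) * gain (pr y) - 1" for t
      by (simp add: \<rho>_def axis_def)
    then show "((\<lambda>t. \<rho> (y + t *\<^sub>R axis 1 1)) has_real_derivative \<sigma> * gain (pr y)) (at 0)"
      by (auto intro!: derivative_eq_intros)
    show "\<sigma> * gain (pr y) \<noteq> 0"
      using gain_ge_1[of "pr y"] y \<open>\<sigma> \<noteq> 0\<close> by (auto simp: U_def)
  qed
  show ?thesis
    unfolding hypersurface_def
  proof (intro conjI ballI)
    fix y0 assume "y0 \<in> {y. pr y \<in> real_tetrablock \<and> \<sigma> * y$1 * gain (pr y) = 1}"
    then show "\<exists>U \<rho>. open U \<and> y0 \<in> U \<and> C_class_on \<infinity> U \<rho> \<and>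
        (\<forall>y\<in>{y. pr y \<in> real_tetrablock \<and> \<sigma> * y$1 * gain (pr y) = 1} \<inter> U.
          \<exists>D. GDERIV \<rho> y :> D \<and> D \<noteq> 0) \<and>
        {y. pr y \<in> real_tetrablock \<and> \<sigma> * y$1 * gain (pr y) = 1} \<inter> U = {y\<in>U. \<rho> y = 0}"
      using U smooth grad
      by (intro exI[of _ U] exI[of _ \<rho>]) (auto simp: U_def \<rho>_def)
  qed simp
qed

lemma vector_4_nth:
  "(vector [a, b, c, d] :: real ^ 4) $ 1 = a" "(vector [a, b, c, d] :: real ^ 4) $ 2 = b"
  "(vector [a, b, c, d] :: real ^ 4) $ 3 = c" "(vector [a, b, c, d] :: real ^ 4) $ 4 = d"
  unfolding vector_def by simp_all

text \<open>Since \<open>gain x \<ge> 1\<close>, the equation \<open>\<sigma> a gain x = 1\<close> forces \<open>0 < \<sigma> a \<le> 1\<close>, so dropping the range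
  condition adds no points.\<close>

lemma graph_gain_eq:
  fixes \<sigma> :: real
  shows "{vector [a, x$1, x$2, x$3] | a x. x \<in> real_tetrablock \<and> 0 \<le> \<sigma> * a \<and> \<sigma> * a \<le> 1 \<and>
      \<sigma> * a * sqrt ((1 - \<bar>zeta1 x\<bar>\<^sup>2) * (1 - \<bar>zeta2 x\<bar>\<^sup>2)) /
       \<bar>1 - x$1 * zeta1 x - x$2 * zeta2 x + x$3 * zeta1 x * zeta2 x\<bar> = 1}
    = {y :: real ^ 4. (vector [y$2, y$3, y$4] :: real ^ 3) \<in> real_tetrablock \<and>
        \<sigma> * y$1 * gain (vector [y$2, y$3, y$4]) = 1}" (is "?L = ?R")
proof -
  have quot: "\<sigma> * a * sqrt ((1 - \<bar>zeta1 x\<bar>\<^sup>2) * (1 - \<bar>zeta2 x\<bar>\<^sup>2)) /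
       \<bar>1 - x$1 * zeta1 x - x$2 * zeta2 x + x$3 * zeta1 x * zeta2 x\<bar> = \<sigma> * a * gain x"
    if "x \<in> real_tetrablock" for a x
    using gain_denominator_pos[OF that] by (simp add: gain_def)
  have range: "0 \<le> s \<and> s \<le> 1" if "x \<in> real_tetrablock" "s * gain x = 1" for s x
  proof -
    have "s = 1 / gain x" using gain_ge_1[OF that(1)] that(2) by (simp add: field_simps)
    then show ?thesis using gain_ge_1[OF that(1)] by simp
  qed
  have coords: "(vector [x$1, x$2, x$3] :: real ^ 3) = x" for x :: "real ^ 3"
    by (simp add: vec_eq_iff forall_3)
  have eta: "(vector [y$1, y$2, y$3, y$4] :: real ^ 4) = y" for y :: "real ^ 4"
    by (simp add: vec_eq_iff forall_4 vector_4_nth)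
  show ?thesis
  proof
    show "?L \<subseteq> ?R"
    proof
      fix y assume "y \<in> ?L"
      then obtain a x where "y = vector [a, x$1, x$2, x$3]" "x \<in> real_tetrablock" "\<sigma> * a * gain x = 1"
        by (auto simp only: mem_Collect_eq quot)
      then show "y \<in> ?R" by (simp add: vector_4_nth coords)
    qed
    show "?R \<subseteq> ?L"
    proof
      fix y assume y: "y \<in> ?R"
      define x where "x = (vector [y$2, y$3, y$4] :: real ^ 3)"
      have "y = vector [y$1, x$1, x$2, x$3]" by (simp add: x_def eta)
      moreover have "x \<in> real_tetrablock" "\<sigma> * y$1 * gain x = 1"
        using y by (simp_all add: x_def)
      ultimately show "y \<in> ?L"
        using range[of x "\<sigma> * y$1"] quot[of x "y$1"] unfolding mem_Collect_eq by metis
    qed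
  qed
qed

theorem lemma6p18:
  shows "hypersurface \<infinity> C5 \<and> hypersurface \<infinity> C6"
proof
  show "hypersurface \<infinity> C5"
    using hypersurface_graph_gain[of 1] graph_gain_eq[of 1] by (simp add: C5_def)
  have "- 1 \<le> a \<and> a \<le> 0 \<longleftrightarrow> 0 \<le> -1 * a \<and> -1 * a \<le> 1" for a :: real by auto
  then have "C6 = {y :: real ^ 4. (vector [y$2, y$3, y$4] :: real ^ 3) \<in> real_tetrablock \<and>
      -1 * y$1 * gain (vector [y$2, y$3, y$4]) = 1}"
    unfolding C6_def using graph_gain_eq[of "-1"] by (smt (verit) Collect_cong mult_minus1)
  then show "hypersurface \<infinity> C6"
    using hypersurface_graph_gain[of "-1"] by simp
qed

end
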